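(* Let $(\mu_1,\dots,\mu_r)$ be a perfect system of bidimensional measures, absolutely continuous with respect to a common measure $\mu$. Let $\vec n=(n_1,\dots,n_r)\in\mathbb{N}^r$, let $P_{\vec n}$ be its associated bivariate Type II multiple orthogonal polynomial, and let $d_{\vec n},k_{\vec n}$ be its degree and remainder. Define $\vec v=(n_1-d_{\vec n}-1,\dots,n_r-d_{\vec n}-1)$. Choose $\vec w_x,\vec w_y\in\mathbb{N}^r$ such that $$|\vec w_x|=\tfrac12(d_{\vec n}+1)(d_{\vec n}+2)+k_{\vec n}=|\vec n|+d_{\vec n}+1,\qquad |\vec w_y|=\tfrac12(d_{\vec n}+1)(d_{\vec n}+2)+k_{\vec n}+1=|\vec n|+d_{\vec n}+2,$$ and $\vec w_y\ge\vec w_x\ge\vec v$ componentwise, and let $P_{\vec w_x},P_{\vec w_y}$ be their associated bivariate Type II multiple orthogonal polynomials. Let $\{\vec m_i:\ i=|\vec n|-(d_{\vec n}+1)r,\dots,|\vec n|+d_{\vec n}+2\}$ be a path of neighbour multi-indices in $\mathbb{N}^r$ with $|\vec m_i|=i$ for every $i$, $\vec m_{|\vec n|-(d_{\vec n}+1)r}=\vec v$, $\vec m_{|\vec n|}=\vec n$, $\vec m_{|\vec n|+d_{\vec n}+1}=\vec w_x$ and $\vec m_{|\vec n|+d_{\vec n}+2}=\vec w_y$. For every $i$ let $P_{\vec m_i}$ be the bivariate Type II multiple orthogonal polynomial and $Q_{\vec m_i}$ the bivariate Type I function associated to $\vec m_i$. Then $$xP_{\vec n}(x,y)=P_{\vec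 w_x}(x,y)+\sum_{i=|\vec n|-(d_{\vec n}+1)r}^{|\vec n|+d_{\vec n}}a_iP_{\vec m_i}(x,y),$$ $$yP_{\vec n}(x,y)=P_{\vec w_y}(x,y)+\sum_{i=|\vec n|-(d_{\vec n}+1)r}^{|\vec n|+d_{\vec n}+1}b_iP_{\vec m_i}(x,y),$$ where $a_{i-1}=\langle xP_{\vec n},Q_{\vec m_i}\rangle_\mu$ and $b_{i-1}=\langle yP_{\vec n},Q_{\vec m_i}\rangle_\mu$.
   Context: Here $\mathbb{N}=\{0,1,2,\dots\}$ and $|\vec n|=n_1+\dots+n_r$. All measures on $\mathbb{R}^2$ are assumed to have finite moments; $d\mu_j=w_j\,d\mu$, $\langle f,g\rangle_j=\int fg\,d\mu_j$ and $\langle f,g\rangle_\mu=\int fg\,d\mu$. The Cantor pairing function is the bijection $\pi:\mathbb{N}^2\to\mathbb{N}$, $\pi(t,s)=\frac12(t+s)(t+s+1)+s$, giving the position (starting at $0$) of $x^ty^s$ in the list $1,x,y,x^2,xy,y^2,\dots$. Write $e_k(x,y)=x^ty^s$ with $(t,s)=\pi^{-1}(k)$. Degree and remainder: if $(l,m)=\pi^{-1}(|\vec n|)$, then $d_{\vec n}=l+m$ and $k_{\vec n}=|\vec n|-\frac12d_{\vec n}(d_{\vec n}+1)=m$. Type II: the bivariate Type II multiple orthogonal polynomial associated to $\vec n$ is the monic polynomial $P_{\vec n}=e_{|\vec n|}+\sum_{k=0}^{|\vec n|-1}c_ke_k$ such that $\langle P_{\vec n},x^ty^s\rangle_j=0$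 whenever $0\le\pi(t,s)\le n_j-1$, $j=1,\dots,r$. Type I: the bivariate Type I multiple orthogonal polynomials associated to $\vec n$ are polynomials $A_{\vec n,j}=\sum_{k=0}^{n_j-1}c_{k,j}e_k$, $j=1,\dots,r$ (with $A_{\vec n,j}=0$ if $n_j=0$), such that $\sum_{j=1}^r\langle A_{\vec n,j},x^ty^s\rangle_j$ equals $0$ if $0\le\pi(t,s)\le|\vec n|-2$ and $1$ if $\pi(t,s)=|\vec n|-1$. The bivariate Type I function is $Q_{\vec n}=\sum_{j=1}^rA_{\vec n,j}w_j$. A multi-index $\vec n$ is normal if $P_{\vec n}$ exists and is unique; equivalently, if the $A_{\vec n,j}$ exist and are unique; equivalently, if the $|\vec n|\times|\vec n|$ matrix $\left(M^{(1)}_{n_1}|\cdots|M^{(r)}_{n_r}\right)$ is regular, where $M^{(j)}_{n_j}$ is the $|\vec n|\times n_j$ matrix with $(k,l)$ entry (from $0$) $\int e_ke_l\,d\mu_j$. A system of measures is perfect if every $\vec n\in\mathbb{N}^r$ is normal. A path of neighbour multi-indices is a sequence of multi-indices in $\mathbb{N}^r$ in which each term is obtained from the previous one by adding a unit vector $\vec e_j$ for some $j\in\{1,\dots,r\}$. In particular the existence of the path requires all components of $\vec v$ to be nonnegative. *)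

theory Defs
  imports "HOL-Analysis.Analysis" "HOL-Library.Nat_Bijection"
begin

section \<open>Graded ordering of the bivariate monomials\<close>

definition cantor_pair :: "nat \<times> nat \<Rightarrow> nat" where
  "cantor_pair = (\<lambda>(t, s). (t + s) * (t + s + 1) div 2 + s)"

text \<open>The library's pairing function is the same one with the two arguments exchanged.\<close>

lemma cantor_pair_eq_prod_encode: "cantor_pair (t, s) = prod_encode (s, t)"
  by (simp add: cantor_pair_def prod_encode_def triangle_def add.commute)

lemma bij_cantor_pair: "bij cantor_pair"
proof -
  have "cantor_pair = prod_encode \<circ> prod.swap"
    by (auto simp: cantor_pair_eq_prod_encode)
  then show ?thesis
    using bij_comp[OF bij_swap bij_prod_encode] by simp
qed

text \<open>Polynomials in two real variables are rendered as functions on the plane. Over the reals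
  the monomials are linearly independent as functions, so this loses nothing.\<close>

definition mono2 :: "nat \<Rightarrow> nat \<Rightarrow> real \<times> real \<Rightarrow> real" where
  "mono2 t s = (\<lambda>(x, y). x ^ t * y ^ s)"

definition basis_mono :: "nat \<Rightarrow> real \<times> real \<Rightarrow> real" where
  "basis_mono k = (case inv cantor_pair k of (t, s) \<Rightarrow> mono2 t s)"


section \<open>Multi-indices\<close>

text \<open>A multi-index with \<open>r\<close> components is a function into \<^typ>\<open>nat\<close> from a finite index
  type with \<open>r\<close> elements.\<close>

definition mi_size :: "('r::finite \<Rightarrow> nat) \<Rightarrow> nat" where
  "mi_size n = (\<Sum>j\<in>UNIV. n j)"

definition mi_degree :: "('r::finite \<Rightarrow> nat) \<Rightarrow> nat" where
  "mi_degree n = (case inv cantor_pair (mi_size n) of (l, m) \<Rightarrow> l + m)"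

definition mi_remainder :: "('r::finite \<Rightarrow> nat) \<Rightarrow> nat" where
  "mi_remainder n = mi_size n - mi_degree n * (mi_degree n + 1) div 2"

text \<open>The truncated subtraction above is exact.\<close>

lemma mi_size_eq_degree_remainder:
  "mi_size n = mi_degree n * (mi_degree n + 1) div 2 + mi_remainder n"
  and mi_remainder_eq_snd: "mi_remainder n = snd (inv cantor_pair (mi_size n))"
proof -
  obtain l m where lm: "inv cantor_pair (mi_size n) = (l, m)"
    by fastforce
  then have "cantor_pair (l, m) = mi_size n"
    by (metis bij_cantor_pair bij_is_surj surj_f_inv_f)
  moreover have "mi_degree n = l + m"
    by (simp add: mi_degree_def lm)
  ultimately have sz: "mi_size n = mi_degree n * (mi_degree n + 1) div 2 + m"
    by (simp add: cantor_pair_def)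
  then have "mi_remainder n = m"
    by (simp add: mi_remainder_def)
  with sz lm show "mi_size n = mi_degree n * (mi_degree n + 1) div 2 + mi_remainder n"
    and "mi_remainder n = snd (inv cantor_pair (mi_size n))"
    by simp_all
qed

lemma mi_size_plus_degree:
  "(mi_degree n + 1) * (mi_degree n + 2) div 2 + mi_remainder n = mi_size n + mi_degree n + 1"
proof -
  let ?d = "mi_degree n"
  have "(?d + 1) * (?d + 2) = ?d * (?d + 1) + (?d + 1) * 2"
    by (simp add: algebra_simps)
  then have "(?d + 1) * (?d + 2) div 2 = ?d * (?d + 1) div 2 + (?d + 1)"
    by (metis div_mult_self2 add.commute mult.commute zero_neq_numeral)
  then show ?thesis
    using mi_size_eq_degree_remainder[of n] by linarith
qed

definition next_neighbour :: "('r \<Rightarrow> nat) \<Rightarrow> ('r \<Rightarrow> nat) \<Rightarrow> bool" where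
  "next_neighbour n n' \<longleftrightarrow> (\<exists>j. n' = n(j := n j + 1))"


section \<open>Measures and weights\<close>

definition finite_moments :: "(real \<times> real) measure \<Rightarrow> bool" where
  "finite_moments N \<longleftrightarrow> (\<forall>t s. integrable N (mono2 t s))"

text \<open>\<open>has_weight \<mu> N w\<close> says \<open>dN = w d\<mu>\<close>. The non-negativity is needed because
  \<^const>\<open>ennreal\<close> truncates negative values to \<open>0\<close>.\<close>

definition has_weight ::
  "'a measure \<Rightarrow> 'a measure \<Rightarrow> ('a \<Rightarrow> real) \<Rightarrow> bool" where
  "has_weight \<mu> N w \<longleftrightarrow>
     w \<in> borel_measurable \<mu> \<and> (AE z in \<mu>. 0 \<le> w z) \<and> N = density \<mu> (\<lambda>z. ennreal (w z))"

lemma has_weight_imp_absolutely_continuous: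
  "has_weight \<mu> N w \<Longrightarrow> absolutely_continuous \<mu> N"
  unfolding has_weight_def by (auto intro: absolutely_continuousI_density)

definition ip :: "'a measure \<Rightarrow> ('a \<Rightarrow> real) \<Rightarrow> ('a \<Rightarrow> real) \<Rightarrow> real" where
  "ip N f g = (\<integral>z. f z * g z \<partial>N)"


section \<open>Bivariate multiple orthogonal polynomials\<close>

definition is_type_II ::
  "('r::finite \<Rightarrow> (real \<times> real) measure) \<Rightarrow> ('r \<Rightarrow> nat) \<Rightarrow> (real \<times> real \<Rightarrow> real) \<Rightarrow> bool" where
  "is_type_II M n P \<longleftrightarrow>
     (\<exists>c. P = (\<lambda>z. basis_mono (mi_size n) z + (\<Sum>k<mi_size n. c k * basis_mono k z))) \<and>
     (\<forall>j t s. cantor_pair (t, s) < n j \<longrightarrow> ip (M j) P (mono2 t s) = 0)"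

text \<open>The two conditions below are \<open>\<pi>(t,s) \<le> |n| - 2\<close> and \<open>\<pi>(t,s) = |n| - 1\<close>,
  written without truncated subtraction.\<close>

definition is_type_I ::
  "('r::finite \<Rightarrow> (real \<times> real) measure) \<Rightarrow> ('r \<Rightarrow> nat) \<Rightarrow> ('r \<Rightarrow> real \<times> real \<Rightarrow> real) \<Rightarrow> bool" where
  "is_type_I M n A \<longleftrightarrow>
     (\<forall>j. \<exists>c. A j = (\<lambda>z. \<Sum>k<n j. c k * basis_mono k z)) \<and>
     (\<forall>t s. (cantor_pair (t, s) + 2 \<le> mi_size n \<longrightarrow>
               (\<Sum>j\<in>UNIV. ip (M j) (A j) (mono2 t s)) = 0) \<and>
            (cantor_pair (t, s) + 1 = mi_size n \<longrightarrow>
               (\<Sum>j\<in>UNIV. ip (M j) (A j) (mono2 t s)) = 1))"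

definition normal_index ::
  "('r::finite \<Rightarrow> (real \<times> real) measure) \<Rightarrow> ('r \<Rightarrow> nat) \<Rightarrow> bool" where
  "normal_index M n \<longleftrightarrow> (\<exists>!P. is_type_II M n P)"

definition perfect_system :: "('r::finite \<Rightarrow> (real \<times> real) measure) \<Rightarrow> bool" where
  "perfect_system M \<longleftrightarrow> (\<forall>n. normal_index M n)"

text \<open>The descriptions below are meaningful for normal multi-indices; there the Type I
  polynomials are unique as well.\<close>

definition type_II ::
  "('r::finite \<Rightarrow> (real \<times> real) measure) \<Rightarrow> ('r \<Rightarrow> nat) \<Rightarrow> real \<times> real \<Rightarrow> real" where
  "type_II M n = (THE P. is_type_II M n P)"

definition type_I ::
  "('r::finite \<Rightarrow> (real \<times> real) measure) \<Rightarrow> ('r \<Rightarrow> nat) \<Rightarrow> 'r \<Rightarrow> real \<times> real \<Rightarrow> real" where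
  "type_I M n = (THE A. is_type_I M n A)"

definition type_I_fun ::
  "('r::finite \<Rightarrow> (real \<times> real) measure) \<Rightarrow> ('r \<Rightarrow> real \<times> real \<Rightarrow> real) \<Rightarrow> ('r \<Rightarrow> nat) \<Rightarrow>
   real \<times> real \<Rightarrow> real" where
  "type_I_fun M w n = (\<lambda>z. \<Sum>j\<in>UNIV. type_I M n j z * w j z)"

end

theory Submission
  imports Defs "Jordan_Normal_Form.Determinant"
begin

text \<open>
  Multiplication by \<open>x\<close> or \<open>y\<close> moves a monomial of degree \<open>\<delta>\<close> up by \<open>\<delta> + 1\<close> or
  \<open>\<delta> + 2\<close> positions in the graded list of monomials. Two things follow. First, the product of a
  coordinate with the Type II polynomial of \<open>n\<close> is again monic, with its leading monomial in the
  position given by the size of \<open>wx\<close> or \<open>wy\<close> (\<open>times_type_II_leading\<close>). Secondly,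
  moving the coordinate to the other factor of the inner product shows that this product keeps all
  orthogonality conditions of \<open>n\<close> except the last \<open>d + 1\<close> for each measure, that is, those of
  \<open>v\<close> (\<open>times_type_II_orthogonal\<close>).

  Any polynomial \<open>f\<close> that satisfies the conditions of the first multi-index \<open>v\<close> of a path is a
  combination of the Type II polynomials along the path
  (\<open>expansion_along_path\<close>). These polynomials have consecutive leading monomials, so
  subtracting suitable multiples of them from the top down leaves a remainder below the size of
  \<open>v\<close>. The path is increasing, so every subtracted polynomial satisfies the conditions of
  \<open>v\<close>, and hence so does the remainder; normality of \<open>v\<close> makes it zero.

  The coefficients come from biorthogonality. Integration against the Type I function of
  \<open>m i\<close> annihilates the Type II polynomials of \<open>m i\<close> and of all later multi-indices
  (\<open>biorthogonal_below\<close>), and on a combination of the first \<open>i\<close> monomials it returns the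
  coefficient of the last one (\<open>type_I_functional_leading_coeff\<close>). So it extracts the
  coefficient of the Type II polynomial of \<open>m (i - 1)\<close>.

  Normality speaks about Type II polynomials only. That the Type I polynomials exist and are unique
  is deduced from it by linear algebra: their defining system is the transpose of the homogeneous
  Type II system, whose kernel is trivial (\<open>normal_index_imp_ex1_type_I\<close>).
\<close>


section \<open>Transposed linear systems\<close>

text \<open>A square matrix with trivial kernel has non-zero determinant, hence so has its transpose. The
  rows are indexed by an arbitrary finite set because the Type II conditions are indexed by pairs of
  a measure and a monomial.\<close>

lemma transposed_system_uniquely_solvable:
  fixes G :: "'i \<Rightarrow> nat \<Rightarrow> real"
  assumes fin: "finite I" and card: "card I = N"
    and inj: "\<And>c k. (\<And>i. i \<in> I \<Longrightarrow> (\<Sum>k<N. G i k * c k) = 0) \<Longrightarrow> k < N \<Longrightarrow> c k = 0"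
  shows "\<exists>x. \<forall>k<N. (\<Sum>i\<in>I. x i * G i k) = b k"
    and "\<And>x i. (\<And>k. k < N \<Longrightarrow> (\<Sum>i\<in>I. x i * G i k) = 0) \<Longrightarrow> i \<in> I \<Longrightarrow> x i = 0"
proof -
  obtain f where f: "bij_betw f {0..<N} I"
    using ex_bij_betw_nat_finite[OF fin] card by auto
  define A where "A = mat N N (\<lambda>(a, k). G (f a) k)"
  have A: "A \<in> carrier_mat N N" and AT: "transpose_mat A \<in> carrier_mat N N"
    by (auto simp: A_def)
  have "det A \<noteq> 0"
  proof
    assume "det A = 0"
    then obtain u where u: "u \<in> carrier_vec N" "u \<noteq> 0\<^sub>v N" "A *\<^sub>v u = 0\<^sub>v N"
      using det_0_iff_vec_prod_zero_field[OF A] by auto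
    have "u $ k = 0" if "k < N" for k
    proof (rule inj[OF _ that])
      fix i assume "i \<in> I"
      then obtain a where a: "a < N" "i = f a"
        using f by (auto simp: bij_betw_def)
      have "(A *\<^sub>v u) $ a = 0" using u(3) a by simp
      then show "(\<Sum>k<N. G i k * u $ k) = 0"
        using a u(1) by (simp add: A_def scalar_prod_def lessThan_atLeast0)
    qed
    then have "u = 0\<^sub>v N" using u(1) by (intro eq_vecI) auto
    with u(2) show False by simp
  qed
  then have detT: "det (transpose_mat A) \<noteq> 0"
    using det_transpose[OF A] by simp
  have entry: "(\<Sum>i\<in>I. x i * G i k) = (transpose_mat A *\<^sub>v vec N (\<lambda>a. x (f a))) $ k"
    if "k < N" for x k
  proof -
    have "(\<Sum>i\<in>I. x i * G i k) = (\<Sum>a\<in>{0..<N}. x (f a) * G (f a) k)"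
      by (rule sum.reindex_bij_betw[OF f, symmetric])
    then show ?thesis
      using that by (simp add: A_def scalar_prod_def mult.commute)
  qed
  show "\<exists>x. \<forall>k<N. (\<Sum>i\<in>I. x i * G i k) = b k"
  proof -
    obtain B where B: "B \<in> carrier_mat N N" "transpose_mat A * B = 1\<^sub>m N"
      using det_non_zero_imp_unit[OF AT detT, of "()"]
      by (auto simp: Units_def ring_mat_def)
    define y where "y = B *\<^sub>v vec N b"
    define x where "x = (\<lambda>i. y $ inv_into {0..<N} f i)"
    have y: "y \<in> carrier_vec N" using B(1) by (auto simp: y_def)
    have "transpose_mat A *\<^sub>v y = vec N b"
      using assoc_mult_mat_vec[OF AT B(1), of "vec N b"] B(2) by (simp add: y_def)
    moreover have "vec N (\<lambda>a. x (f a)) = y"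
      using f y by (intro eq_vecI) (auto simp: x_def bij_betw_def)
    ultimately show ?thesis
      using entry[of _ x] by (intro exI[of _ x]) simp
  qed
  show "x i = 0" if z: "\<And>k. k < N \<Longrightarrow> (\<Sum>i\<in>I. x i * G i k) = 0" and i: "i \<in> I" for x i
  proof -
    have "transpose_mat A *\<^sub>v vec N (\<lambda>a. x (f a)) = 0\<^sub>v N"
      using entry[of _ x] z AT by (intro eq_vecI) auto
    then have "vec N (\<lambda>a. x (f a)) = 0\<^sub>v N"
      using detT det_0_iff_vec_prod_zero_field[OF AT] vec_carrier by blast
    moreover obtain a where "a < N" "i = f a"
      using f i by (auto simp: bij_betw_def)
    ultimately show ?thesis
      by (metis index_vec index_zero_vec(1))
  qed
qed


section \<open>Multiplying monomials by the coordinates\<close>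

lemma basis_mono_cantor_pair: "basis_mono (cantor_pair (t, s)) = mono2 t s"
  by (simp add: basis_mono_def inv_f_f[OF bij_is_inj[OF bij_cantor_pair]])

lemma ex_cantor_pair: "\<exists>t s. k = cantor_pair (t, s)"
  using bij_is_surj[OF bij_cantor_pair] by (metis surj_def surj_pair)

lemma cantor_pair_triangle: "cantor_pair (t, s) = triangle (t + s) + s"
  by (simp add: cantor_pair_def triangle_def)

definition basis_degree :: "nat \<Rightarrow> nat" where
  "basis_degree k = (case inv_into UNIV cantor_pair k of (t, s) \<Rightarrow> t + s)"

lemma basis_degree_cantor_pair: "basis_degree (cantor_pair (t, s)) = t + s"
  by (simp add: basis_degree_def inv_f_f[OF bij_is_inj[OF bij_cantor_pair]])

lemma mi_degree_eq_basis_degree: "mi_degree n = basis_degree (mi_size n)"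
  by (simp add: mi_degree_def basis_degree_def)

lemma triangle_mono: "a \<le> b \<Longrightarrow> triangle a \<le> triangle b"
  by (induction b rule: dec_induct) auto

lemma degree_le_cantor_pair: "t + s \<le> cantor_pair (t, s)"
proof -
  have "a \<le> triangle a" for a by (induction a) auto
  from this[of "t + s"] show ?thesis by (simp add: cantor_pair_triangle)
qed

lemma basis_degree_bounds:
  "triangle (basis_degree k) \<le> k" "k \<le> triangle (basis_degree k) + basis_degree k"
proof -
  obtain t s where k: "k = cantor_pair (t, s)" using ex_cantor_pair by blast
  have "basis_degree k = t + s" unfolding k by (rule basis_degree_cantor_pair)
  moreover have "k = triangle (t + s) + s" unfolding k by (rule cantor_pair_triangle)
  ultimately show "triangle (basis_degree k) \<le> k" "k \<le> triangle (basis_degree k) + basis_degree k"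
    by simp_all
qed

lemma basis_degree_mono:
  assumes "k \<le> l" shows "basis_degree k \<le> basis_degree l"
proof (rule ccontr)
  assume "\<not> ?thesis"
  then have "triangle (Suc (basis_degree l)) \<le> triangle (basis_degree k)"
    by (intro triangle_mono) simp
  then show False
    using assms basis_degree_bounds[of k] basis_degree_bounds[of l] by simp
qed

text \<open>Multiplying \<open>x^t y^s\<close> by \<open>x\<close> moves it past the \<open>t\<close> later monomials of its
  own degree and the first \<open>s\<close> monomials of the next degree; multiplying by \<open>y\<close> moves it
  past one more.\<close>

lemma fst_times_basis_mono:
  "fst z * basis_mono k z = basis_mono (k + basis_degree k + 1) z"
proof -
  obtain t s where k: "k = cantor_pair (t, s)" using ex_cantor_pair by blast
  then have "k + basis_degree k + 1 = cantor_pair (Suc t, s)"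
    unfolding k basis_degree_cantor_pair by (simp add: cantor_pair_triangle)
  then show ?thesis
    by (cases z) (simp only: k basis_mono_cantor_pair, simp add: mono2_def)
qed

lemma snd_times_basis_mono:
  "snd z * basis_mono k z = basis_mono (k + basis_degree k + 2) z"
proof -
  obtain t s where k: "k = cantor_pair (t, s)" using ex_cantor_pair by blast
  then have "k + basis_degree k + 2 = cantor_pair (t, Suc s)"
    unfolding k basis_degree_cantor_pair by (simp add: cantor_pair_triangle)
  then show ?thesis
    by (cases z) (simp only: k basis_mono_cantor_pair, simp add: mono2_def)
qed

text \<open>The first \<open>N\<close> monomials fit into the square grid of exponents up to \<open>N\<close>. On the
  grid a vanishing combination is a polynomial in \<open>y\<close> whose coefficients are polynomials in
  \<open>x\<close>, so the univariate identity theorem applies twice.\<close>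

lemma basis_mono_linear_independent:
  assumes zero: "\<And>z. (\<Sum>k<N. c k * basis_mono k z) = 0" and k: "k < N"
  shows "c k = 0"
proof -
  define c' where "c' k = (if k < N then c k else 0)" for k
  have grid: "(\<Sum>s\<le>N. (\<Sum>t\<le>N. c' (cantor_pair (t, s)) * x ^ t) * y ^ s) = 0" for x y
  proof -
    have "(\<Sum>s\<le>N. (\<Sum>t\<le>N. c' (cantor_pair (t, s)) * x ^ t) * y ^ s) =
          (\<Sum>s\<le>N. \<Sum>t\<le>N. c' (cantor_pair (t, s)) * basis_mono (cantor_pair (t, s)) (x, y))"
      by (simp add: basis_mono_cantor_pair mono2_def sum_distrib_right mult.assoc)
    also have "\<dots> = (\<Sum>t\<le>N. \<Sum>s\<le>N. c' (cantor_pair (t, s)) * basis_mono (cantor_pair (t, s)) (x, y))"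
      by (rule sum.swap)
    also have "\<dots> = (\<Sum>p\<in>{..N}\<times>{..N}. c' (cantor_pair p) * basis_mono (cantor_pair p) (x, y))"
      by (simp add: sum.cartesian_product case_prod_unfold)
    also have "\<dots> = (\<Sum>k\<in>cantor_pair ` ({..N}\<times>{..N}). c' k * basis_mono k (x, y))"
      by (subst sum.reindex) (auto intro: inj_on_subset[OF bij_is_inj[OF bij_cantor_pair]])
    also have "\<dots> = (\<Sum>k<N. c' k * basis_mono k (x, y))"
    proof (rule sum.mono_neutral_right)
      show "{..<N} \<subseteq> cantor_pair ` ({..N}\<times>{..N})"
      proof
        fix k assume k: "k \<in> {..<N}"
        obtain t s where ts: "k = cantor_pair (t, s)" using ex_cantor_pair by blast
        then have "t + s \<le> k" using degree_le_cantor_pair by simp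
        then show "k \<in> cantor_pair ` ({..N}\<times>{..N})"
          using k ts by (intro image_eqI[of _ _ "(t, s)"]) auto
      qed
    qed (auto simp: c'_def)
    also have "\<dots> = 0" using zero[of "(x, y)"] by (simp add: c'_def)
    finally show ?thesis .
  qed
  have "c' (cantor_pair (t, s)) = 0" if "t \<le> N" "s \<le> N" for t s
  proof -
    have "(\<Sum>t\<le>N. c' (cantor_pair (t, s)) * x ^ t) = 0" for x
      using grid[of x] that polyfun_eq_0[of "\<lambda>s. (\<Sum>t\<le>N. c' (cantor_pair (t, s)) * x ^ t)" N]
      by blast
    then show ?thesis
      using that polyfun_eq_0[of "\<lambda>t. c' (cantor_pair (t, s))" N] by blast
  qed
  moreover obtain t s where ts: "k = cantor_pair (t, s)" using ex_cantor_pair by blast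
  moreover have "t + s \<le> k" using degree_le_cantor_pair ts by simp
  ultimately have "c' k = 0" using k by simp
  then show ?thesis using k by (simp add: c'_def)
qed


section \<open>Polynomials below a given position\<close>

definition polys_below :: "nat \<Rightarrow> (real \<times> real \<Rightarrow> real) set" where
  "polys_below N = {f. \<exists>c. f = (\<lambda>z. \<Sum>k<N. c k * basis_mono k z)}"

lemma polys_below_combination: "(\<lambda>z. \<Sum>k<N. c k * basis_mono k z) \<in> polys_below N"
  by (auto simp: polys_below_def)

lemma polys_below_zero: "(\<lambda>z. 0) \<in> polys_below N"
  using polys_below_combination[of "\<lambda>_. 0" N] by simp

lemma polys_below_add_scaled:
  assumes "f \<in> polys_below N" "g \<in> polys_below N"
  shows "(\<lambda>z. f z + a * g z) \<in> polys_below N"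
proof -
  obtain c d where "f = (\<lambda>z. \<Sum>k<N. c k * basis_mono k z)" "g = (\<lambda>z. \<Sum>k<N. d k * basis_mono k z)"
    using assms by (auto simp: polys_below_def)
  then have "(\<lambda>z. f z + a * g z) = (\<lambda>z. \<Sum>k<N. (c k + a * d k) * basis_mono k z)"
    by (simp add: sum_distrib_left sum.distrib algebra_simps)
  then show ?thesis by (auto simp: polys_below_def)
qed

lemma basis_mono_in_polys_below:
  assumes "k < N" shows "basis_mono k \<in> polys_below N"
proof -
  have "basis_mono k = (\<lambda>z. \<Sum>i<N. (if i = k then 1 else 0) * basis_mono i z)"
    using assms by (simp add: if_distrib[of "\<lambda>a. a * _"] cong: if_cong)
  then show ?thesis
    using polys_below_combination by metis
qed

lemma polys_below_sum:
  assumes "\<And>i. i \<in> I \<Longrightarrow> f i \<in> polys_below N"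
  shows "(\<lambda>z. \<Sum>i\<in>I. c i * f i z) \<in> polys_below N"
  using assms
proof (induction I rule: infinite_finite_induct)
  case (insert i I)
  then show ?case
    using polys_below_add_scaled[of "\<lambda>z. \<Sum>i\<in>I. c i * f i z" N "f i" "c i"]
    by (simp add: add.commute)
qed (simp_all add: polys_below_zero)

lemma polys_below_mono:
  assumes "f \<in> polys_below N" "N \<le> N'" shows "f \<in> polys_below N'"
proof -
  obtain c where "f = (\<lambda>z. \<Sum>k<N. c k * basis_mono k z)"
    using assms by (auto simp: polys_below_def)
  then show ?thesis
    using assms(2) by (auto intro!: polys_below_sum basis_mono_in_polys_below)
qed

lemma monic_in_polys_below:
  assumes "g \<in> polys_below N"
  shows "(\<lambda>z. basis_mono N z + g z) \<in> polys_below (Suc N)"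
  using polys_below_add_scaled[OF basis_mono_in_polys_below[OF lessI] polys_below_mono[OF assms], of N 1]
  by simp

lemma polys_below_SucE:
  assumes "f \<in> polys_below (Suc N)"
  obtains a g where "g \<in> polys_below N" "f = (\<lambda>z. g z + a * basis_mono N z)"
  using assms polys_below_combination by (force simp: polys_below_def)

text \<open>Finite moments make single monomials integrable, and this suffices since a product of two
  monomials is a monomial.\<close>

lemma integrable_poly_product:
  assumes mom: "finite_moments \<nu>" and "f \<in> polys_below K" "g \<in> polys_below L"
  shows "integrable \<nu> (\<lambda>z. f z * g z)"
proof -
  have mono: "integrable \<nu> (\<lambda>z. basis_mono k z * basis_mono l z)" for k l
  proof -
    obtain t s t' s' where "k = cantor_pair (t, s)" "l = cantor_pair (t', s')"
      using ex_cantor_pair by metis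
    then have "(\<lambda>z. basis_mono k z * basis_mono l z) = mono2 (t + t') (s + s')"
      by (auto simp: basis_mono_cantor_pair mono2_def power_add)
    then show ?thesis using mom by (simp add: finite_moments_def)
  qed
  obtain c d where "f = (\<lambda>z. \<Sum>k<K. c k * basis_mono k z)" "g = (\<lambda>z. \<Sum>k<L. d k * basis_mono k z)"
    using assms by (auto simp: polys_below_def)
  then have "(\<lambda>z. f z * g z) =
      (\<lambda>z. \<Sum>k<K. \<Sum>l<L. c k * d l * (basis_mono k z * basis_mono l z))"
    by (simp add: sum_product mult_ac)
  then show ?thesis by (auto intro!: integrable_sum integrable_mult_right mono)
qed

lemma borel_measurable_poly:
  assumes "f \<in> polys_below N" shows "f \<in> borel_measurable borel"
proof -
  have "basis_mono k \<in> borel_measurable borel" for k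
  proof -
    obtain t s where "k = cantor_pair (t, s)" using ex_cantor_pair by blast
    then have "basis_mono k = (\<lambda>z. fst z ^ t * snd z ^ s)"
      by (auto simp: basis_mono_cantor_pair mono2_def)
    then show ?thesis by (auto intro!: borel_measurable_continuous_onI continuous_intros)
  qed
  then show ?thesis using assms by (auto simp: polys_below_def)
qed

lemma ip_commute: "ip \<nu> f g = ip \<nu> g f"
  by (simp add: ip_def mult.commute)

lemma ip_sum_left:
  assumes "finite_moments \<nu>" "\<And>i. i \<in> I \<Longrightarrow> f i \<in> polys_below K" "g \<in> polys_below L"
  shows "ip \<nu> (\<lambda>z. \<Sum>i\<in>I. c i * f i z) g = (\<Sum>i\<in>I. c i * ip \<nu> (f i) g)"
proof -
  have "ip \<nu> (\<lambda>z. \<Sum>i\<in>I. c i * f i z) g = (\<integral>z. (\<Sum>i\<in>I. c i * (f i z * g z)) \<partial>\<nu>)"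
    by (simp add: ip_def sum_distrib_right mult.assoc)
  also have "\<dots> = (\<Sum>i\<in>I. c i * ip \<nu> (f i) g)"
    using assms by (subst Bochner_Integration.integral_sum)
      (auto simp: ip_def intro: integrable_mult_right integrable_poly_product)
  finally show ?thesis .
qed

lemma ip_add_scaled_left:
  assumes "finite_moments \<nu>" "f \<in> polys_below K" "g \<in> polys_below K" "h \<in> polys_below L"
  shows "ip \<nu> (\<lambda>z. f z + a * g z) h = ip \<nu> f h + a * ip \<nu> g h"
  using assms integrable_poly_product[OF assms(1,2,4)] integrable_poly_product[OF assms(1,3,4)]
  by (simp add: ip_def distrib_right mult.assoc)


section \<open>Type II polynomials\<close>

definition orthogonal_at ::
  "('r \<Rightarrow> (real \<times> real) measure) \<Rightarrow> ('r \<Rightarrow> nat) \<Rightarrow> (real \<times> real \<Rightarrow> real) \<Rightarrow> bool" where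
  "orthogonal_at M n f \<longleftrightarrow> (\<forall>j. \<forall>k<n j. ip (M j) f (basis_mono k) = 0)"

text \<open>Transfers conditions between positions in the list of monomials and pairs of exponents.\<close>

lemma all_basis_mono: "(\<forall>k. Q k (basis_mono k)) \<longleftrightarrow> (\<forall>t s. Q (cantor_pair (t, s)) (mono2 t s))"
  by (metis basis_mono_cantor_pair ex_cantor_pair)

lemma is_type_II_iff:
  "is_type_II M n P \<longleftrightarrow>
     (\<exists>g\<in>polys_below (mi_size n). P = (\<lambda>z. basis_mono (mi_size n) z + g z)) \<and> orthogonal_at M n P"
proof -
  have "orthogonal_at M n P \<longleftrightarrow>
      (\<forall>j t s. cantor_pair (t, s) < n j \<longrightarrow> ip (M j) P (mono2 t s) = 0)"
    unfolding orthogonal_at_def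
    using all_basis_mono[of "\<lambda>k e. k < n _ \<longrightarrow> ip (M _) P e = 0"] by blast
  then show ?thesis
    unfolding is_type_II_def by (auto simp: polys_below_def)
qed

lemma orthogonal_at_add_scaled:
  assumes "\<And>j. finite_moments (M j)" "f \<in> polys_below K" "g \<in> polys_below K"
    and "orthogonal_at M n f" "orthogonal_at M n g"
  shows "orthogonal_at M n (\<lambda>z. f z + a * g z)"
  using assms ip_add_scaled_left[OF assms(1-3) basis_mono_in_polys_below[OF lessI]]
  by (simp add: orthogonal_at_def)

lemma orthogonal_at_mono:
  "orthogonal_at M n f \<Longrightarrow> (\<And>j. n' j \<le> n j) \<Longrightarrow> orthogonal_at M n' f"
  unfolding orthogonal_at_def by (meson order_less_le_trans)

lemma is_type_II_in_polys_below:
  assumes "is_type_II M n P" shows "P \<in> polys_below (Suc (mi_size n))"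
proof -
  obtain g where g: "g \<in> polys_below (mi_size n)" "P = (\<lambda>z. basis_mono (mi_size n) z + g z)"
    using assms by (auto simp: is_type_II_iff)
  then show ?thesis
    using monic_in_polys_below by simp
qed

text \<open>Adding such an \<open>f\<close> to the Type II polynomial gives a Type II polynomial again, so
  uniqueness forces \<open>f\<close> to vanish.\<close>

lemma normal_index_orthogonal_imp_zero:
  assumes mom: "\<And>j. finite_moments (M j)" and normal: "normal_index M n"
    and f: "f \<in> polys_below (mi_size n)" and orth: "orthogonal_at M n f"
  shows "f = (\<lambda>z. 0)"
proof -
  obtain P where P: "is_type_II M n P"
    using normal by (auto simp: normal_index_def)
  then obtain g where g: "g \<in> polys_below (mi_size n)"
      "P = (\<lambda>z. basis_mono (mi_size n) z + g z)"
    by (auto simp: is_type_II_iff)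
  have "orthogonal_at M n (\<lambda>z. P z + 1 * f z)"
  proof (rule orthogonal_at_add_scaled[OF mom is_type_II_in_polys_below[OF P] _ _ orth])
    show "f \<in> polys_below (Suc (mi_size n))"
      using f by (rule polys_below_mono) simp
    show "orthogonal_at M n P"
      using P by (simp add: is_type_II_iff)
  qed
  moreover have "(\<lambda>z. g z + 1 * f z) \<in> polys_below (mi_size n)"
    using g f by (intro polys_below_add_scaled)
  ultimately have "is_type_II M n (\<lambda>z. P z + f z)"
    unfolding is_type_II_iff g(2) by (auto simp: add.assoc intro!: bexI[of _ "\<lambda>z. g z + f z"])
  then have "P = (\<lambda>z. P z + f z)"
    using normal P by (auto simp: normal_index_def)
  then show ?thesis by (metis add_cancel_left_right)
qed

lemma is_type_II_type_II: "normal_index M n \<Longrightarrow> is_type_II M n (type_II M n)"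
  using theI'[of "is_type_II M n"] by (simp add: type_II_def normal_index_def)

lemma type_II_in_polys_below: "normal_index M n \<Longrightarrow> type_II M n \<in> polys_below (Suc (mi_size n))"
  using is_type_II_in_polys_below[OF is_type_II_type_II] .

lemma orthogonal_at_type_II: "normal_index M n \<Longrightarrow> orthogonal_at M n (type_II M n)"
  using is_type_II_type_II by (auto simp: is_type_II_iff)

lemma normal_index_if_perfect: "perfect_system M \<Longrightarrow> normal_index M n"
  by (simp add: perfect_system_def)


section \<open>Type I polynomials\<close>

lemma is_type_I_iff:
  "is_type_I M n A \<longleftrightarrow>
     (\<forall>j. A j \<in> polys_below (n j)) \<and>
     (\<forall>k<mi_size n. (\<Sum>j\<in>UNIV. ip (M j) (A j) (basis_mono k)) =
        (if Suc k = mi_size n then 1 else 0))"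
proof -
  have "(k < mi_size n \<longrightarrow> x = (if Suc k = mi_size n then 1 else 0)) \<longleftrightarrow>
      (k + 2 \<le> mi_size n \<longrightarrow> x = 0) \<and> (k + 1 = mi_size n \<longrightarrow> x = 1)" for k and x :: real
    by auto
  then show ?thesis
    unfolding is_type_I_def
    using all_basis_mono[of "\<lambda>k e. k < mi_size n \<longrightarrow> (\<Sum>j\<in>UNIV. ip (M j) (A j) e) =
        (if Suc k = mi_size n then 1 else 0)"]
    by (simp add: polys_below_def)
qed

text \<open>The rows of the moment matrix \<open>G\<close> are indexed by pairs of a measure \<open>j\<close> and a
  position \<open>l < n j\<close>. A vector in its kernel is the coefficient vector of a polynomial below
  position \<open>mi_size n\<close> that satisfies all Type II conditions. This polynomial vanishes by
  normality, and so do its coefficients by linear independence of the monomials. The Type I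
  conditions are the transposed system.\<close>

lemma normal_index_imp_ex1_type_I:
  fixes M :: "'r::finite \<Rightarrow> (real \<times> real) measure"
  assumes mom: "\<And>j. finite_moments (M j)" and normal: "normal_index M n"
  shows "\<exists>!A. is_type_I M n A"
proof -
  define I where "I = Sigma (UNIV :: 'r set) (\<lambda>j. {..<n j})"
  define G where "G = (\<lambda>(j, l) k. ip (M j) (basis_mono l) (basis_mono k))"
  have fin: "finite I" and card: "card I = mi_size n"
    by (simp_all add: I_def mi_size_def)
  have inj: "c k = 0"
    if ker: "\<And>i. i \<in> I \<Longrightarrow> (\<Sum>k<mi_size n. G i k * c k) = 0" and k: "k < mi_size n" for c k
  proof -
    define f where "f = (\<lambda>z. \<Sum>k<mi_size n. c k * basis_mono k z)"
    have "ip (M j) f (basis_mono l) = (\<Sum>k<mi_size n. G (j, l) k * c k)" for j l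
      unfolding f_def using mom
      by (subst ip_sum_left[where K = "mi_size n" and L = "Suc l"])
        (auto simp: G_def ip_commute mult.commute intro: basis_mono_in_polys_below)
    then have "orthogonal_at M n f"
      using ker by (auto simp: orthogonal_at_def I_def)
    then have "f = (\<lambda>z. 0)"
      by (intro normal_index_orthogonal_imp_zero[OF mom normal])
        (auto simp: f_def polys_below_combination)
    then show ?thesis
      using basis_mono_linear_independent[of c, OF _ k] by (metis f_def)
  qed
  have expand: "(\<Sum>j\<in>UNIV. ip (M j) (\<lambda>z. \<Sum>l<n j. x (j, l) * basis_mono l z) (basis_mono k)) =
      (\<Sum>i\<in>I. x i * G i k)" for x k
  proof -
    have "ip (M j) (\<lambda>z. \<Sum>l<n j. x (j, l) * basis_mono l z) (basis_mono k) =
        (\<Sum>l<n j. x (j, l) * G (j, l) k)" for j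
      using mom by (subst ip_sum_left[where K = "n j" and L = "Suc k"])
        (auto simp: G_def intro: basis_mono_in_polys_below)
    then show ?thesis
      by (simp add: I_def sum.Sigma case_prod_unfold)
  qed
  show ?thesis
  proof (rule ex_ex1I)
    have "\<exists>x. \<forall>k<mi_size n. (\<Sum>i\<in>I. x i * G i k) = (if Suc k = mi_size n then 1 else 0)"
      by (rule transposed_system_uniquely_solvable(1)[OF fin card]) (rule inj)
    then obtain x where "\<forall>k<mi_size n. (\<Sum>i\<in>I. x i * G i k) = (if Suc k = mi_size n then 1 else 0)"
      by blast
    then have "is_type_I M n (\<lambda>j z. \<Sum>l<n j. x (j, l) * basis_mono l z)"
      by (simp add: is_type_I_iff polys_below_combination expand)
    then show "\<exists>A. is_type_I M n A" by blast
  next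
    fix A A' assume A: "is_type_I M n A" and A': "is_type_I M n A'"
    obtain c where c: "A = (\<lambda>j z. \<Sum>l<n j. c j l * basis_mono l z)"
      using A unfolding is_type_I_def by metis
    obtain c' where c': "A' = (\<lambda>j z. \<Sum>l<n j. c' j l * basis_mono l z)"
      using A' unfolding is_type_I_def by metis
    have "(\<Sum>i\<in>I. (case_prod c i - case_prod c' i) * G i k) = 0" if "k < mi_size n" for k
    proof -
      have "(\<Sum>i\<in>I. case_prod c i * G i k) = (if Suc k = mi_size n then 1 else 0)"
        unfolding expand[symmetric] using A that by (simp add: is_type_I_iff c)
      moreover have "(\<Sum>i\<in>I. case_prod c' i * G i k) = (if Suc k = mi_size n then 1 else 0)"
        unfolding expand[symmetric] using A' that by (simp add: is_type_I_iff c')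
      ultimately show ?thesis
        by (simp only: left_diff_distrib sum_subtractf diff_self)
    qed
    then have "case_prod c i - case_prod c' i = 0" if "i \<in> I" for i
      by (rule transposed_system_uniquely_solvable(2)[OF fin card, rotated])
        (use that in \<open>auto intro: inj\<close>)
    then have "c j l = c' j l" if "l < n j" for j l
      using that by (force simp: I_def)
    then show "A = A'" by (simp add: c c')
  qed
qed

lemma is_type_I_type_I:
  "(\<And>j. finite_moments (M j)) \<Longrightarrow> normal_index M n \<Longrightarrow> is_type_I M n (type_I M n)"
  unfolding type_I_def by (rule theI'[OF normal_index_imp_ex1_type_I])


section \<open>The functional represented by the Type I function\<close>

definition type_I_functional ::
  "('r::finite \<Rightarrow> (real \<times> real) measure) \<Rightarrow> ('r \<Rightarrow> nat) \<Rightarrow> (real \<times> real \<Rightarrow> real) \<Rightarrow> real" where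
  "type_I_functional M n f = (\<Sum>j\<in>UNIV. ip (M j) f (type_I M n j))"

text \<open>Passing from \<open>\<mu>\<close> to the measures \<open>M j\<close> removes the weights, and from then on
  only bilinearity and the defining conditions of the Type I polynomials are used. Splitting the
  integral into a sum over \<open>j\<close> requires each weighted term to be integrable.\<close>

lemma ip_type_I_fun:
  assumes sets: "sets \<mu> = sets borel" and mom: "\<And>j. finite_moments (M j)"
    and wt: "\<And>j. has_weight \<mu> (M j) (w j)"
    and normal: "normal_index M n" and f: "f \<in> polys_below N"
  shows "ip \<mu> f (type_I_fun M w n) = type_I_functional M n f"
proof -
  let ?A = "type_I M n"
  have A: "?A j \<in> polys_below (n j)" for j
    using is_type_I_type_I[OF mom normal] by (simp add: is_type_I_iff)
  have meas: "(\<lambda>z. f z * ?A j z) \<in> borel_measurable \<mu>" for j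
    using borel_measurable_poly[OF f] borel_measurable_poly[OF A[of j]]
    by (simp add: measurable_cong_sets[OF sets refl])
  have w: "w j \<in> borel_measurable \<mu>" "AE z in \<mu>. 0 \<le> w j z"
      "M j = density \<mu> (\<lambda>z. ennreal (w j z))" for j
    using wt[of j] by (auto simp: has_weight_def)
  have int: "integrable \<mu> (\<lambda>z. w j z * (f z * ?A j z))" for j
    using integrable_poly_product[OF mom f A, of j j] integrable_density[OF meas w(1,2), of j]
    by (simp add: w(3)[symmetric])
  have "ip \<mu> f (type_I_fun M w n) = (\<integral>z. (\<Sum>j\<in>UNIV. w j z * (f z * ?A j z)) \<partial>\<mu>)"
    by (simp add: ip_def type_I_fun_def sum_distrib_left mult_ac)
  also have "\<dots> = (\<Sum>j\<in>UNIV. \<integral>z. w j z * (f z * ?A j z) \<partial>\<mu>)"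
    using int by (rule Bochner_Integration.integral_sum)
  also have "\<dots> = (\<Sum>j\<in>UNIV. ip (M j) f (?A j))"
  proof (rule sum.cong[OF refl])
    fix j
    show "(\<integral>z. w j z * (f z * ?A j z) \<partial>\<mu>) = ip (M j) f (?A j)"
      using integral_density[OF meas w(1,2), of j j] by (simp add: ip_def w(3)[symmetric])
  qed
  finally show ?thesis by (simp add: type_I_functional_def)
qed

context
  fixes M :: "'r::finite \<Rightarrow> (real \<times> real) measure" and n :: "'r \<Rightarrow> nat"
  assumes mom: "\<And>j. finite_moments (M j)" and normal: "normal_index M n"
begin

lemma type_I_in_polys_below: "type_I M n j \<in> polys_below (n j)"
  using is_type_I_type_I[OF mom normal] by (simp add: is_type_I_iff)

lemma type_I_functional_add_scaled:
  assumes "f \<in> polys_below K" "g \<in> polys_below K"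
  shows "type_I_functional M n (\<lambda>z. f z + a * g z) =
    type_I_functional M n f + a * type_I_functional M n g"
  using ip_add_scaled_left[OF mom assms type_I_in_polys_below]
  by (simp add: type_I_functional_def sum.distrib sum_distrib_left)

text \<open>The \<open>j\<close>-th Type I polynomial is a combination of the monomials before position
  \<open>n j\<close>, and \<open>f\<close> is orthogonal to these with respect to \<open>M j\<close>.\<close>

lemma type_I_functional_orthogonal:
  assumes f: "f \<in> polys_below K" and "orthogonal_at M n f"
  shows "type_I_functional M n f = 0"
proof -
  have "ip (M j) f (type_I M n j) = 0" for j
  proof -
    obtain c where c: "type_I M n j = (\<lambda>z. \<Sum>l<n j. c l * basis_mono l z)"
      using type_I_in_polys_below[of j] by (auto simp: polys_below_def)
    have "ip (M j) (type_I M n j) f = (\<Sum>l<n j. c l * ip (M j) (basis_mono l) f)"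
      unfolding c using mom f by (intro ip_sum_left) (auto intro: basis_mono_in_polys_below)
    then show ?thesis
      using assms(2) by (simp add: orthogonal_at_def ip_commute[of _ _ f])
  qed
  then show ?thesis by (simp add: type_I_functional_def)
qed

text \<open>The Type I conditions prescribe the values of the functional on the first \<open>mi_size n\<close>
  monomials: \<open>1\<close> on the last of them and \<open>0\<close> on the others.\<close>

lemma type_I_functional_leading_coeff:
  assumes g: "g \<in> polys_below N" and size: "mi_size n = Suc N"
  shows "type_I_functional M n (\<lambda>z. g z + a * basis_mono N z) = a"
proof -
  have I: "(\<Sum>j\<in>UNIV. ip (M j) (type_I M n j) (basis_mono k)) = (if k = N then 1 else 0)"
    if "k \<le> N" for k
    using is_type_I_type_I[OF mom normal] that size by (simp add: is_type_I_iff)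
  obtain c where c: "g = (\<lambda>z. \<Sum>k<N. c k * basis_mono k z)"
    using g by (auto simp: polys_below_def)
  have "type_I_functional M n g =
      (\<Sum>j\<in>UNIV. \<Sum>k<N. c k * ip (M j) (basis_mono k) (type_I M n j))"
    unfolding type_I_functional_def c
    by (intro sum.cong refl ip_sum_left[OF mom basis_mono_in_polys_below type_I_in_polys_below]) auto
  also have "\<dots> = (\<Sum>k<N. c k * (\<Sum>j\<in>UNIV. ip (M j) (type_I M n j) (basis_mono k)))"
    by (subst sum.swap) (simp add: sum_distrib_left ip_commute)
  also have "\<dots> = 0" using I by simp
  finally have "type_I_functional M n g = 0" .
  moreover have "type_I_functional M n (basis_mono N) = 1"
    using I[of N] by (simp add: type_I_functional_def ip_commute)
  moreover have "g \<in> polys_below (Suc N)" "basis_mono N \<in> polys_below (Suc N)"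
    using g by (auto intro: polys_below_mono basis_mono_in_polys_below)
  ultimately show ?thesis
    using type_I_functional_add_scaled by simp
qed

lemma biorthogonal_below:
  assumes "normal_index M n'" and "\<And>j. n j \<le> n' j"
  shows "type_I_functional M n (type_II M n') = 0"
  by (rule type_I_functional_orthogonal[OF type_II_in_polys_below[OF assms(1)]
        orthogonal_at_mono[OF orthogonal_at_type_II[OF assms(1)] assms(2)]])

end


section \<open>Expansion along a path of neighbour multi-indices\<close>

lemma next_neighbour_le: "next_neighbour n n' \<Longrightarrow> n j \<le> n' j"
  by (auto simp: next_neighbour_def)

lemma path_mono:
  assumes "\<And>i. s \<le> i \<Longrightarrow> i < K \<Longrightarrow> next_neighbour (p i) (p (Suc i))"
    and "s \<le> i" "i \<le> i'" "i' \<le> K"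
  shows "p i j \<le> p i' j"
  using assms(3,2,4)
proof (induction i' rule: dec_induct)
  case (step l)
  then show ?case
    using next_neighbour_le[OF assms(1), of l j] by simp
qed simp

text \<open>Splitting off the multiple of a Type II polynomial with the same leading term lowers
  \<open>f\<close> by one position. It preserves the orthogonality conditions of \<open>p s\<close> because the path
  increases, and the functionals further down the path do not see it because of biorthogonality.\<close>

lemma subtract_leading_type_II:
  fixes M :: "'r::finite \<Rightarrow> (real \<times> real) measure"
  assumes mom: "\<And>j. finite_moments (M j)" and perfect: "perfect_system M"
    and path: "\<And>i. s \<le> i \<Longrightarrow> i < K \<Longrightarrow> next_neighbour (p i) (p (Suc i))"
    and size: "mi_size (p K) = K" and "s \<le> K"
    and g: "g \<in> polys_below K" and f: "f = (\<lambda>z. g z + a * basis_mono K z)"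
    and orth: "orthogonal_at M (p s) f"
    and f': "f' = (\<lambda>z. f z + (- a) * type_II M (p K) z)"
  shows "f' \<in> polys_below K" and "orthogonal_at M (p s) f'"
    and "\<And>i. i \<in> {s..<K} \<Longrightarrow>
      type_I_functional M (p (Suc i)) f' = type_I_functional M (p (Suc i)) f"
proof -
  define P where "P = type_II M (p K)"
  have normal: "normal_index M n" for n
    using perfect by (rule normal_index_if_perfect)
  obtain h where h: "h \<in> polys_below K" and P: "P = (\<lambda>z. basis_mono K z + h z)"
    using is_type_II_type_II[OF normal, of "p K"] size by (auto simp: P_def is_type_II_iff)
  have P_below: "P \<in> polys_below (Suc K)"
    using type_II_in_polys_below[OF normal, of "p K"] size by (simp add: P_def)
  have f_below: "f \<in> polys_below (Suc K)"
    unfolding f using g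
    by (intro polys_below_add_scaled basis_mono_in_polys_below) (auto intro: polys_below_mono)
  show "f' \<in> polys_below K"
    using polys_below_add_scaled[OF g h, of "- a"]
    by (simp add: f' P_def[symmetric] f P algebra_simps)
  show "orthogonal_at M (p s) f'"
    unfolding f' P_def[symmetric]
  proof (rule orthogonal_at_add_scaled[OF mom f_below P_below orth])
    show "orthogonal_at M (p s) P"
      unfolding P_def using path \<open>s \<le> K\<close>
      by (intro orthogonal_at_mono[OF orthogonal_at_type_II[OF normal]] path_mono[of s K p]) auto
  qed
  fix i assume i: "i \<in> {s..<K}"
  have "type_I_functional M (p (Suc i)) P = 0"
    unfolding P_def using path i
    by (intro biorthogonal_below[OF mom normal normal] path_mono[of s K p]) auto
  then show "type_I_functional M (p (Suc i)) f' = type_I_functional M (p (Suc i)) f"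
    unfolding f' P_def[symmetric]
    using type_I_functional_add_scaled[OF mom normal f_below P_below, where a = "- a"] by simp
qed

text \<open>Induction on the upper end \<open>K\<close> of the path. At the start \<open>f\<close> lies below the size of the
  first multi-index and satisfies all of its orthogonality conditions, so it vanishes by normality.
  In the step, the functional of the last multi-index reads off the coefficient of \<open>f\<close> at the
  new top monomial, and the corresponding multiple of the Type II polynomial is split off.\<close>

lemma expansion_along_path:
  fixes M :: "'r::finite \<Rightarrow> (real \<times> real) measure"
  assumes mom: "\<And>j. finite_moments (M j)" and perfect: "perfect_system M"
    and "\<And>i. s \<le> i \<Longrightarrow> i < K \<Longrightarrow> next_neighbour (p i) (p (Suc i))"
    and "\<And>i. s \<le> i \<Longrightarrow> i \<le> K \<Longrightarrow> mi_size (p i) = i"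
    and "s \<le> K" and "f \<in> polys_below K" and "orthogonal_at M (p s) f"
  shows "f z = (\<Sum>i\<in>{s..<K}. type_I_functional M (p (Suc i)) f * type_II M (p i) z)"
  using assms(5,3,4,6,7)
proof (induction K arbitrary: f rule: dec_induct)
  case base
  then have "f = (\<lambda>z. 0)"
    using normal_index_orthogonal_imp_zero[OF mom normal_index_if_perfect[OF perfect], of f "p s"]
    by simp
  then show ?case by simp
next
  case (step K)
  note path = step.prems(1) and size = step.prems(2)
  let ?F = "\<lambda>i. type_I_functional M (p i)"
  obtain a g where g: "g \<in> polys_below K" and f: "f = (\<lambda>z. g z + a * basis_mono K z)"
    using step.prems(3) by (rule polys_below_SucE)
  have a: "a = ?F (Suc K) f"
    unfolding f using g size step.hyps
    by (subst type_I_functional_leading_coeff[OF mom normal_index_if_perfect[OF perfect]]) auto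
  define f' where "f' = (\<lambda>z. f z + (- a) * type_II M (p K) z)"
  have path_K: "next_neighbour (p i) (p (Suc i))" if "s \<le> i" "i < K" for i
    using path that by simp
  have size_K: "mi_size (p K) = K"
    using size step.hyps by simp
  note sub = subtract_leading_type_II[OF mom perfect path_K size_K step.hyps(1) g f
      step.prems(4) f'_def]
  have "f' z = (\<Sum>i\<in>{s..<K}. ?F (Suc i) f' * type_II M (p i) z)"
    by (rule step.IH[OF path_K _ sub(1,2)]) (use size in auto)
  also have "\<dots> = (\<Sum>i\<in>{s..<K}. ?F (Suc i) f * type_II M (p i) z)"
    using sub(3) by simp
  finally show ?case
    using step.hyps a by (simp add: f'_def)
qed

text \<open>For a monic polynomial the path may end at the size of the polynomial itself: its top
  coefficient is known, so no further multi-index is needed to extract it.\<close>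

lemma monic_expansion_along_path:
  fixes M :: "'r::finite \<Rightarrow> (real \<times> real) measure"
  assumes mom: "\<And>j. finite_moments (M j)" and perfect: "perfect_system M"
    and path: "\<And>i. s \<le> i \<Longrightarrow> i < K \<Longrightarrow> next_neighbour (p i) (p (Suc i))"
    and size: "\<And>i. s \<le> i \<Longrightarrow> i \<le> K \<Longrightarrow> mi_size (p i) = i"
    and "s \<le> K" and g: "g \<in> polys_below K" and f: "f = (\<lambda>z. basis_mono K z + g z)"
    and orth: "orthogonal_at M (p s) f"
  shows "f z = type_II M (p K) z +
    (\<Sum>i\<in>{s..<K}. type_I_functional M (p (Suc i)) f * type_II M (p i) z)"
proof -
  define f' where "f' = (\<lambda>z. f z + (- 1) * type_II M (p K) z)"
  have f1: "f = (\<lambda>z. g z + 1 * basis_mono K z)"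
    by (simp add: f add.commute)
  have size_K: "mi_size (p K) = K"
    using size \<open>s \<le> K\<close> by simp
  note sub = subtract_leading_type_II[OF mom perfect path size_K \<open>s \<le> K\<close> g f1 orth f'_def]
  have "f' z = (\<Sum>i\<in>{s..<K}. type_I_functional M (p (Suc i)) f' * type_II M (p i) z)"
    by (rule expansion_along_path[OF mom perfect path size \<open>s \<le> K\<close> sub(1,2)])
  then show ?thesis
    using sub(3) by (simp add: f'_def)
qed


section \<open>Multiplication of Type II polynomials by the coordinates\<close>

text \<open>Both coordinates \<open>q\<close> are instances of the following situation: \<open>q\<close> moves the
  monomial in position \<open>k\<close> to position \<open>k + basis_degree k + \<epsilon>\<close>, with \<open>\<epsilon> = 1\<close> for
  \<open>x\<close> and \<open>\<epsilon> = 2\<close> for \<open>y\<close>.\<close>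

lemma times_type_II_leading:
  assumes shift: "\<And>k z. q z * basis_mono k z = basis_mono (k + basis_degree k + \<epsilon>) z"
    and P: "is_type_II M n P"
  obtains g where "g \<in> polys_below (mi_size n + mi_degree n + \<epsilon>)"
    "(\<lambda>z. q z * P z) = (\<lambda>z. basis_mono (mi_size n + mi_degree n + \<epsilon>) z + g z)"
proof -
  let ?N = "mi_size n"
  obtain c where c: "P = (\<lambda>z. basis_mono ?N z + (\<Sum>k<?N. c k * basis_mono k z))"
    using P by (auto simp: is_type_II_def)
  define g where "g = (\<lambda>z. \<Sum>k<?N. c k * basis_mono (k + basis_degree k + \<epsilon>) z)"
  have "k + basis_degree k + \<epsilon> < ?N + mi_degree n + \<epsilon>" if "k < ?N" for k
    using basis_degree_mono[of k ?N] that by (simp add: mi_degree_eq_basis_degree)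
  then have "g \<in> polys_below (?N + mi_degree n + \<epsilon>)"
    unfolding g_def by (intro polys_below_sum basis_mono_in_polys_below) simp
  moreover have "q z * P z = basis_mono (?N + mi_degree n + \<epsilon>) z + g z" for z
  proof -
    have "q z * P z = q z * basis_mono ?N z + (\<Sum>k<?N. c k * (q z * basis_mono k z))"
      by (simp add: c distrib_left sum_distrib_left mult_ac)
    then show ?thesis
      unfolding shift by (simp add: g_def mi_degree_eq_basis_degree)
  qed
  ultimately show ?thesis using that by blast
qed

text \<open>Moving \<open>q\<close> to the test monomial turns position \<open>k\<close> into
  \<open>k + basis_degree k + \<epsilon>\<close>, which has to stay below \<open>n j\<close>. The bound
  \<open>basis_degree k \<le> mi_degree n\<close> is enough for \<open>\<epsilon> = 1\<close>, but for \<open>\<epsilon> = 2\<close> it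
  misses by one. The inequality is in fact strict: at most \<open>mi_degree n\<close> monomials of degree
  \<open>mi_degree n\<close> lie before position \<open>mi_size n\<close>, whereas \<open>k\<close> is followed by at least
  \<open>mi_degree n + 1\<close> positions that do.\<close>

lemma times_type_II_orthogonal:
  assumes shift: "\<And>k z. q z * basis_mono k z = basis_mono (k + basis_degree k + \<epsilon>) z"
    and "\<epsilon> \<le> 2" and P: "is_type_II M n P"
    and n': "\<And>j. n' j + mi_degree n + 1 = n j"
  shows "orthogonal_at M n' (\<lambda>z. q z * P z)"
  unfolding orthogonal_at_def
proof (intro allI impI)
  fix j k assume k: "k < n' j"
  let ?d = "mi_degree n"
  have "n j \<le> mi_size n"
    unfolding mi_size_def by (rule member_le_sum) auto
  moreover have "mi_size n \<le> triangle ?d + ?d"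
    using basis_degree_bounds by (simp add: mi_degree_eq_basis_degree)
  ultimately have "k < triangle ?d"
    using k n'[of j] by simp
  have "basis_degree k < ?d"
  proof (rule ccontr)
    assume "\<not> ?thesis"
    then have "triangle ?d \<le> triangle (basis_degree k)"
      by (simp add: triangle_mono)
    with \<open>k < triangle ?d\<close> basis_degree_bounds(1)[of k] show False by simp
  qed
  then have "k + basis_degree k + \<epsilon> < n j"
    using k n'[of j] \<open>\<epsilon> \<le> 2\<close> by simp
  then have "ip (M j) P (basis_mono (k + basis_degree k + \<epsilon>)) = 0"
    using P by (auto simp: is_type_II_iff orthogonal_at_def)
  then show "ip (M j) (\<lambda>z. q z * P z) (basis_mono k) = 0"
    by (simp add: ip_def shift[symmetric] mult_ac)
qed

text \<open>The integer \<open>s\<close> is the size of the multi-index \<open>p s\<close>, hence a natural number, and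
  the expansion along a path with natural indices applies.\<close>

lemma times_type_II_expansion:
  fixes M :: "'r::finite \<Rightarrow> (real \<times> real) measure" and n :: "'r \<Rightarrow> nat"
    and p :: "int \<Rightarrow> 'r \<Rightarrow> nat"
  assumes sets: "sets \<mu> = sets borel" and mom: "\<And>j. finite_moments (M j)"
    and wt: "\<And>j. has_weight \<mu> (M j) (w j)" and perfect: "perfect_system M"
    and shift: "\<And>k z. q z * basis_mono k z = basis_mono (k + basis_degree k + \<epsilon>) z"
    and eps: "\<epsilon> \<le> 2" and K: "K = int (mi_size n + mi_degree n + \<epsilon>)"
    and "s \<le> K"
    and size: "\<And>i. i \<in> {s..K} \<Longrightarrow> int (mi_size (p i)) = i"
    and path: "\<And>i. i \<in> {s..K - 1} \<Longrightarrow> next_neighbour (p i) (p (i + 1))"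
    and start: "\<And>j. p s j + mi_degree n + 1 = n j"
    and coeff: "\<And>i. i \<in> {s + 1..K} \<Longrightarrow>
      a (i - 1) = ip \<mu> (\<lambda>z. q z * type_II M n z) (type_I_fun M w (p i))"
  shows "q z * type_II M n z = type_II M (p K) z + (\<Sum>i\<in>{s..K - 1}. a i * type_II M (p i) z)"
proof -
  define f where "f = (\<lambda>z. q z * type_II M n z)"
  have normal: "normal_index M n'" for n'
    using perfect by (rule normal_index_if_perfect)
  note II = is_type_II_type_II[OF normal, of n]
  obtain s' where s: "s = int s'"
    using size[of s] \<open>s \<le> K\<close> by (metis atLeastAtMost_iff order_refl)
  define K' where "K' = mi_size n + mi_degree n + \<epsilon>"
  have K: "K = int K'" by (simp add: K K'_def)
  obtain g where g: "g \<in> polys_below K'" "f = (\<lambda>z. basis_mono K' z + g z)"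
    using times_type_II_leading[OF shift II] by (auto simp: f_def K'_def)
  have "f \<in> polys_below (Suc K')"
    using monic_in_polys_below[OF g(1)] by (simp add: g(2))
  then have F: "type_I_functional M n' f = ip \<mu> f (type_I_fun M w n')" for n'
    using ip_type_I_fun[OF sets mom wt normal] by simp
  have "f z = type_II M (p (int K')) z +
      (\<Sum>i\<in>{s'..<K'}. type_I_functional M (p (int (Suc i))) f * type_II M (p (int i)) z)"
  proof (rule monic_expansion_along_path[OF mom perfect, of s' K' "\<lambda>i. p (int i)"])
    show "next_neighbour (p (int i)) (p (int (Suc i)))" if "s' \<le> i" "i < K'" for i
      using path[of "int i"] that by (simp add: s K add.commute)
    show "mi_size (p (int i)) = i" if "s' \<le> i" "i \<le> K'" for i
      using size[of "int i"] that by (simp add: s K)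
    show "s' \<le> K'" using \<open>s \<le> K\<close> by (simp add: s K)
    show "orthogonal_at M (p (int s')) f"
      unfolding f_def using start by (intro times_type_II_orthogonal[OF shift eps II]) (simp add: s)
  qed (use g in auto)
  also have "(\<Sum>i\<in>{s'..<K'}. type_I_functional M (p (int (Suc i))) f * type_II M (p (int i)) z) =
      (\<Sum>i\<in>{s'..<K'}. a (int i) * type_II M (p (int i)) z)"
  proof (rule sum.cong[OF refl])
    fix i assume "i \<in> {s'..<K'}"
    then show "type_I_functional M (p (int (Suc i))) f * type_II M (p (int i)) z =
        a (int i) * type_II M (p (int i)) z"
      using coeff[of "int (Suc i)", folded f_def] by (simp add: s K F)
  qed
  also have "\<dots> = (\<Sum>i\<in>int ` {s'..<K'}. a i * type_II M (p i) z)"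
    by (simp add: sum.reindex)
  also have "int ` {s'..<K'} = {s..K - 1}"
    by (auto simp: s K image_int_atLeastLessThan)
  finally show ?thesis by (simp add: f_def K)
qed

theorem theorem4p7:
  fixes \<mu> :: "(real \<times> real) measure"
    and M :: "'r::finite \<Rightarrow> (real \<times> real) measure"
    and w :: "'r \<Rightarrow> real \<times> real \<Rightarrow> real"
    and n wx wy :: "'r \<Rightarrow> nat"
    and v :: "'r \<Rightarrow> int"
    and d k :: nat
    and start :: int
    and m :: "int \<Rightarrow> 'r \<Rightarrow> nat"
    and a b :: "int \<Rightarrow> real"
  assumes "sets \<mu> = sets borel"
    and "\<And>j. finite_moments (M j)"
    and "\<And>j. has_weight \<mu> (M j) (w j)"
    and "perfect_system M"
    and "d = mi_degree n" and "k = mi_remainder n"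
    and "v = (\<lambda>j. int (n j) - int d - 1)"
    and "mi_size wx = (d + 1) * (d + 2) div 2 + k"
    and "mi_size wy = (d + 1) * (d + 2) div 2 + k + 1"
    and "\<And>j. wx j \<le> wy j" and "\<And>j. v j \<le> int (wx j)"
    and "start = int (mi_size n) - (int d + 1) * int CARD('r)"
    and "\<And>i. i \<in> {start..int (mi_size n) + int d + 2} \<Longrightarrow> int (mi_size (m i)) = i"
    and "\<And>i. i \<in> {start..int (mi_size n) + int d + 1} \<Longrightarrow> next_neighbour (m i) (m (i + 1))"
    and "\<And>j. int (m start j) = v j"
    and "m (int (mi_size n)) = n"
    and "m (int (mi_size n) + int d + 1) = wx"
    and "m (int (mi_size n) + int d + 2) = wy"
    and "\<And>i. i \<in> {start + 1..int (mi_size n) + int d + 1} \<Longrightarrow>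
           a (i - 1) = ip \<mu> (\<lambda>(x, y). x * type_II M n (x, y)) (type_I_fun M w (m i))"
    and "\<And>i. i \<in> {start + 1..int (mi_size n) + int d + 2} \<Longrightarrow>
           b (i - 1) = ip \<mu> (\<lambda>(x, y). y * type_II M n (x, y)) (type_I_fun M w (m i))"
  shows "(\<forall>x y. x * type_II M n (x, y) =
            type_II M wx (x, y) +
            (\<Sum>i\<in>{start..int (mi_size n) + int d}. a i * type_II M (m i) (x, y))) \<and>
         (\<forall>x y. y * type_II M n (x, y) =
            type_II M wy (x, y) +
            (\<Sum>i\<in>{start..int (mi_size n) + int d + 1}. b i * type_II M (m i) (x, y)))"
proof -
  let ?N = "int (mi_size n)"
  note expansion = times_type_II_expansion[OF assms(1,2,3,4), where n = n and s = start and p = m]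
  have le: "start \<le> ?N"
    unfolding assms(12) by simp
  have start: "m start j + mi_degree n + 1 = n j" for j
  proof -
    have "int (m start j) = int (n j) - int (mi_degree n) - 1"
      using assms(15)[of j] unfolding assms(5,7) .
    then show ?thesis by linarith
  qed
  have size: "int (mi_size (m i)) = i" if "i \<in> {start..?N + int d + 2}" for i
    using that by (rule assms(13))
  have path: "next_neighbour (m i) (m (i + 1))" if "i \<in> {start..?N + int d + 1}" for i
    using that by (rule assms(14))
  have x: "fst z * type_II M n z = type_II M (m (?N + int d + 1)) z +
      (\<Sum>i\<in>{start..?N + int d + 1 - 1}. a i * type_II M (m i) z)" for z
  proof (rule expansion[OF fst_times_basis_mono])
    show "a (i - 1) = ip \<mu> (\<lambda>z. fst z * type_II M n z) (type_I_fun M w (m i))"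
      if "i \<in> {start + 1..?N + int d + 1}" for i
      using assms(19)[OF that] by (simp only: case_prod_unfold prod.collapse)
    show "?N + int d + 1 = int (mi_size n + mi_degree n + 1)"
      unfolding assms(5) by simp
    show "int (mi_size (m i)) = i" if "i \<in> {start..?N + int d + 1}" for i
      using that by (intro size) simp
    show "next_neighbour (m i) (m (i + 1))" if "i \<in> {start..?N + int d + 1 - 1}" for i
      using that by (intro path) simp
  qed (use le start in simp_all)
  have y: "snd z * type_II M n z = type_II M (m (?N + int d + 2)) z +
      (\<Sum>i\<in>{start..?N + int d + 2 - 1}. b i * type_II M (m i) z)" for z
  proof (rule expansion[OF snd_times_basis_mono])
    show "b (i - 1) = ip \<mu> (\<lambda>z. snd z * type_II M n z) (type_I_fun M w (m i))"
      if "i \<in> {start + 1..?N + int d + 2}" for i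
      using assms(20)[OF that] by (simp only: case_prod_unfold prod.collapse)
    show "?N + int d + 2 = int (mi_size n + mi_degree n + 2)"
      unfolding assms(5) by simp
    show "int (mi_size (m i)) = i" if "i \<in> {start..?N + int d + 2}" for i
      using that by (rule size)
    show "next_neighbour (m i) (m (i + 1))" if "i \<in> {start..?N + int d + 2 - 1}" for i
      using that by (intro path) simp
  qed (use le start in simp_all)
  have last: "?N + int d + 1 - 1 = ?N + int d" "?N + int d + 2 - 1 = ?N + int d + 1"
    by simp_all
  show ?thesis
    using x y unfolding last assms(17,18) by (metis fst_conv snd_conv)
qed


end
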